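(* Let $\lambda$ be a nonzero real number. For every integer $n\ge 0$ and every $r\in\mathbb{N}$ (that is, $r\ge1$), $$\frac{1}{(1-y)^{r}}HF_{n,\lambda}^{(r)}\Big(\frac{y}{1-y}\Big)=\frac{1}{(1-y)^{\lambda}}\sum_{k=0}^{\infty}(k)_{n,\lambda}\bigg(H_{k,\lambda}^{(r)}+\binom{r+k-1}{k}\log_{\lambda}(1-y)\bigg)y^{k}.$$ Equivalently, $$HF_{n,\lambda}^{(r)}(y)=(1+y)^{\lambda-r}\sum_{k=0}^{\infty}(k)_{n,\lambda}\bigg(H_{k,\lambda}^{(r)}+\binom{r+k-1}{k} \log_{\lambda}\Big(\frac{1}{1+y}\Big)\bigg)\Big(\frac{y}{1+y}\Big)^{k}.$$
   Context: Fix a nonzero real $\lambda$. All identities are identities of formal power series (in $y$ with real coefficients for the claim), with $(1+u)^{a}=\sum_{j\ge0}\binom{a}{j}u^{j}$. Notation: $(x)_{0,\lambda}=1$ and $(x)_{n,\lambda}=x(x-\lambda)\cdots(x-(n-1)\lambda)$ for $n\ge1$. Degenerate logarithm: $\log_{\lambda}(1+t)=\frac{1}{\lambda}\big((1+t)^{\lambda}-1\big)$; thus $\log_\lambda\big(\frac{1}{1+y}\big)=\frac1\lambda\big((1+y)^{-\lambda}-1\big)$. Degenerate exponential: $e_{\lambda}(t)=(1+\lambda t)^{1/\lambda}=\sum_{n\ge0}(1)_{n,\lambda}\frac{t^{n}}{n!}$. Degenerate harmonic numbers $H_{n,\lambda}$: defined by $H_{0,\lambda}=0$ and $-\frac{\log_{\lambda}(1-t)}{1-t}=\sum_{n=1}^{\infty}H_{n,\lambda}t^{n}$.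 Degenerate hyperharmonic numbers: $H_{0,\lambda}^{(r)}=0$ $(r\ge1)$, $H_{n,\lambda}^{(1)}=H_{n,\lambda}$, and $H_{n,\lambda}^{(r)}=\sum_{k=1}^{n}H_{k,\lambda}^{(r-1)}$ for $r\ge2$, $n\ge1$; equivalently $-\frac{\log_{\lambda}(1-t)}{(1-t)^{r}}=\sum_{n=1}^{\infty}H_{n,\lambda}^{(r)}t^{n}$. Degenerate hyperharmonic-Fubini polynomials $HF_{n,\lambda}^{(r)}(y)$, $r\ge1$: defined by $$-\frac{\log_{\lambda}\big(1-y(e_{\lambda}(t)-1)\big)}{\big(1-y(e_{\lambda}(t)-1)\big)^{r}}=\sum_{n=1}^{\infty}HF_{n,\lambda}^{(r)}(y)\frac{t^{n}}{n!},$$ with the convention $HF_{0,\lambda}^{(r)}(y)=0$. *)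

theory Defs
  imports "HOL-Computational_Algebra.Computational_Algebra"
begin

unbundle fps_syntax

text \<open>Real power of a power series with constant term \<open>1\<close>: writing the series as \<open>1 + u\<close>,
  this is the binomial series \<open>\<Sum>j. (a gchoose j) * u ^ j\<close>. It is not meaningful for
  any other constant term.\<close>

definition fps_rpow :: "real fps \<Rightarrow> real \<Rightarrow> real fps" where
  "fps_rpow f a = fps_binomial a oo (f - 1)"

text \<open>The degenerate logarithm, exponential and falling factorial. The argument of \<open>dlog\<close> is the
  full series (\<open>1 + t\<close>, say), not its difference from \<open>1\<close>; its constant term must be \<open>1\<close>.\<close>

definition dlog :: "real \<Rightarrow> real fps \<Rightarrow> real fps" where
  "dlog lam f = fps_const (1 / lam) * (fps_rpow f lam - 1)"

definition dexp :: "real \<Rightarrow> real fps" where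
  "dexp lam = fps_rpow (1 + fps_const lam * fps_X) (1 / lam)"

definition dfall :: "real \<Rightarrow> nat \<Rightarrow> real \<Rightarrow> real" where
  "dfall x n lam = (\<Prod>i<n. x - real i * lam)"

definition dharm :: "real \<Rightarrow> nat \<Rightarrow> real" where
  "dharm lam n = (- dlog lam (1 - fps_X) / (1 - fps_X)) $ n"

text \<open>Only orders \<open>r \<ge> 1\<close> are meaningful; the value at \<open>r = 0\<close> is arbitrary.\<close>

fun dhyper :: "real \<Rightarrow> nat \<Rightarrow> nat \<Rightarrow> real" where
  "dhyper lam 0 n = 0"
| "dhyper lam (Suc 0) n = dharm lam n"
| "dhyper lam (Suc (Suc r)) n = (\<Sum>k=1..n. dhyper lam (Suc r) k)"

lemma dhyper_0 [simp]: "dhyper lam r 0 = 0"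
  by (cases "(lam, r, 0 :: nat)" rule: dhyper.cases)
     (auto simp: dharm_def dlog_def fps_rpow_def fps_divide_unit)

lemma dhyper_gf:
  "Abs_fps (dhyper lam (Suc r)) = - dlog lam (1 - fps_X) / (1 - fps_X) ^ Suc r"
proof (induction r)
  case 0
  show ?case by (simp add: dharm_def fps_eq_iff)
next
  case (Suc r)
  have "- dlog lam (1 - fps_X) / (1 - fps_X) ^ Suc (Suc r) =
        (- dlog lam (1 - fps_X) / (1 - fps_X) ^ Suc r) * inverse (1 - fps_X)"
    by (simp add: fps_divide_unit fps_inverse_mult mult_ac)
  also have "\<dots> = Abs_fps (dhyper lam (Suc r)) * Abs_fps (\<lambda>_. 1)"
    by (simp add: Suc.IH fps_inverse_gp'[symmetric])
  also have "\<dots> = Abs_fps (dhyper lam (Suc (Suc r)))"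
    by (intro fps_ext) (simp add: fps_mult_nth sum.atLeast_Suc_atMost)
  finally show ?case by (rule sym)
qed

text \<open>The hyperharmonic-Fubini polynomials are polynomials in \<open>y\<close>, so their generating function
  is a power series in \<open>t\<close> over \<^typ>\<open>real poly\<close>, in which \<open>y\<close> is \<open>[:0, 1:]\<close>. Fractional powers and
  inverses are not available over that ring, so \<open>u = y * (dexp lam - 1)\<close> is substituted
  into the real series \<open>- dlog lam (1 - u) / (1 - u) ^ r\<close>.
  The lemma \<open>poly_HF\<close> below recovers the generating function with \<open>u\<close> written in place,
  for every real value of \<open>y\<close>.\<close>

definition fps_lift :: "real fps \<Rightarrow> real poly fps" where
  "fps_lift f = Abs_fps (\<lambda>n. [:f $ n:])"

definition HF_gf :: "real \<Rightarrow> nat \<Rightarrow> real poly fps" where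
  "HF_gf lam r = fps_lift (- dlog lam (1 - fps_X) / (1 - fps_X) ^ r)
     oo (fps_const [:0, 1:] * fps_lift (dexp lam - 1))"

definition HF :: "real \<Rightarrow> nat \<Rightarrow> nat \<Rightarrow> real poly" where
  "HF lam r n = smult (fact n) (HF_gf lam r $ n)"

lemma dexp_nth:
  assumes "lam \<noteq> 0"
  shows "dexp lam $ n = dfall 1 n lam / fact n"
proof -
  have "dexp lam $ n = lam ^ n * ((1 / lam) gchoose n)"
    by (simp add: dexp_def fps_rpow_def fps_compose_linear)
  also have "\<dots> = (\<Prod>i<n. lam * (1 / lam - real i)) / fact n"
    by (simp add: gbinomial_prod_rev prod.distrib atLeast0LessThan)
  also have "(\<Prod>i<n. lam * (1 / lam - real i)) = dfall 1 n lam"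
    unfolding dfall_def using assms by (intro prod.cong) (auto simp: field_simps)
  finally show ?thesis .
qed

lemma poly_HF:
  "poly (HF lam r n) y = fact n *
     (- dlog lam (1 - fps_const y * (dexp lam - 1)) / (1 - fps_const y * (dexp lam - 1)) ^ r) $ n"
proof -
  define ev :: "real poly fps \<Rightarrow> real fps" where "ev F = Abs_fps (\<lambda>n. poly (F $ n) y)" for F
  define u where "u = fps_const y * (dexp lam - 1)"
  define g where "g = - dlog lam (1 - fps_X) / (1 - fps_X) ^ r"
  have u0: "u $ 0 = 0" by (simp add: u_def dexp_def fps_rpow_def)
  have u_neq_1: "u \<noteq> 1" using u0 by auto
  have ev_mult: "ev (F * G) = ev F * ev G" for F G
    by (intro fps_ext) (simp add: ev_def fps_mult_nth poly_sum)
  have ev_power: "ev (F ^ i) = ev F ^ i" for F i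
    by (induction i) (simp_all add: ev_mult, simp add: ev_def fps_eq_iff)
  have ev_compose: "ev (F oo G) = ev F oo ev G" for F G
  proof (rule fps_ext)
    fix n
    have *: "poly (F ^ i $ n) y = (ev F ^ i) $ n" for F i n
      unfolding ev_power[symmetric] by (simp add: ev_def)
    show "ev (F oo G) $ n = (ev F oo ev G) $ n"
      unfolding fps_compose_nth *[symmetric]
      by (simp add: ev_def fps_compose_nth poly_sum *)
  qed
  have ev_lift: "ev (fps_lift f) = f" for f
    by (simp add: ev_def fps_lift_def fps_eq_iff)
  have ev_const: "ev (fps_const [:0, 1:]) = fps_const y"
    by (simp add: ev_def fps_eq_iff fps_const_def)
  have "poly (HF lam r n) y = fact n * ev (HF_gf lam r) $ n"
    by (simp add: HF_def ev_def)
  also have "ev (HF_gf lam r) = g oo u"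
    by (simp only: HF_gf_def ev_compose ev_mult ev_lift ev_const g_def u_def)
  also have "g oo u = - dlog lam (1 - u) / (1 - u) ^ r"
  proof -
    have pow: "((1 - fps_X) ^ r oo u) = (1 - u) ^ r"
      by (simp add: fps_compose_power[OF u0, symmetric] fps_compose_sub_distrib u0)
    have "fps_binomial lam oo (1 - fps_X - 1) oo u = fps_binomial lam oo ((1 - fps_X - 1) oo u)"
      using u0 by (intro fps_compose_assoc[symmetric]) auto
    also have "(1 - fps_X - 1) oo u = 1 - u - 1"
      by (simp add: fps_compose_uminus u0)
    finally have "dlog lam (1 - fps_X) oo u = dlog lam (1 - u)"
      by (simp add: dlog_def fps_rpow_def fps_compose_mult_distrib[OF u0] fps_compose_sub_distrib)
    thus ?thesis
      unfolding g_def
      by (subst fps_compose_divide_distrib)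
         (auto simp: u0 pow fps_compose_uminus u_neq_1)
  qed
  finally show ?thesis by (simp only: u_def)
qed

end

theory Submission
  imports Defs
begin

text \<open>
  Write \<open>B a\<close> for \<open>(1 - X) powr a\<close>, that is, \<open>fps_rpow (1 - fps_X) a\<close>. Both sides of the claim are
  built from series \<open>B a\<close> by multiplying the coefficients termwise with weights depending on \<open>n\<close>
  (\<open>hadamard\<close>). On the right, the weights \<open>(k)\<^sub>n\<^sub>,\<^sub>\<lambda>\<close> act as an operator \<open>D\<close>; it is the degenerate
  analogue of \<open>(X d/dX) ^ n\<close>. On the left, expanding the generating function in powers of
  \<open>u = y (e\<^sub>\<lambda>(t) - 1)\<close> shows that \<open>HF\<close> is the result of an operator \<open>T\<close> on
  \<open>g = - log\<^sub>\<lambda>(1 - X) / (1 - X) ^ r\<close>, whose weights are the numbers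
  \<open>dsurj n m = n! [t ^ n] (e\<^sub>\<lambda>(t) - 1) ^ m\<close>.

  The two weights are tied together by
  \<open>(k)\<^sub>n\<^sub>,\<^sub>\<lambda> = (\<Sum>m\<le>n. dsurj n m * (k choose m))\<close>, which is the binomial expansion of
  \<open>e\<^sub>\<lambda>(t) ^ k = (1 + (e\<^sub>\<lambda>(t) - 1)) ^ k\<close> (lemma \<open>dfall_eq_sum_dsurj\<close>). As weighting the coefficients
  of \<open>B a\<close> by \<open>k choose m\<close> gives a multiple of \<open>X ^ m * B (a - m)\<close>, this yields
  \<open>D (B a) = B a * (T (B a) oo X / (1 - X))\<close> for every real \<open>a\<close> (lemma
  \<open>hadamard_dfall_rpow\<close>), the heart of the argument.

  Now \<open>g = (B (-r) - B (\<lambda> - r)) / \<lambda>\<close> and \<open>log\<^sub>\<lambda>(1 - X) = (B \<lambda> - 1) / \<lambda>\<close>, so the series in the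
  claim is \<open>D g + log\<^sub>\<lambda>(1 - X) * D (B (-r)) = (B \<lambda> * D (B (-r)) - D (B (\<lambda> - r))) / \<lambda>\<close>: the
  logarithmic term serves exactly to cancel \<open>D (B (-r))\<close> and replace it by \<open>B \<lambda> * D (B (-r))\<close>. Then
  both terms carry the factor \<open>B (\<lambda> - r)\<close>, and what remains is \<open>T g\<close> at \<open>X / (1 - X)\<close>. The second
  form of the identity follows by the substitution \<open>X / (1 + X)\<close>, the compositional inverse of
  \<open>X / (1 - X)\<close>.
\<close>

section \<open>Convergence of series of formal power series\<close>

text \<open>Convergence of power series means that each coefficient is eventually constant. Stating the
  assumption for all coefficients below \<open>N\<close> at once lets the same hypothesis serve after a
  substitution, in \<open>fps_sums_compose\<close>.\<close>

lemma fps_sumsI: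
  fixes f :: "nat \<Rightarrow> 'a :: comm_ring_1 fps"
  assumes "\<And>N i. i < N \<Longrightarrow> (\<Sum>k<N. f k) $ i = S $ i"
  shows "f sums S"
  unfolding sums_def
proof (rule tendsto_fpsI)
  fix i
  show "eventually (\<lambda>N. (\<Sum>k<N. f k) $ i = S $ i) sequentially"
    using eventually_gt_at_top[of i] by eventually_elim (rule assms)
qed

lemma fps_compose_nth_cong_below:
  fixes F G :: "'a :: comm_ring_1 fps"
  assumes "\<And>i. i < N \<Longrightarrow> F $ i = G $ i" and "i < N"
  shows "(F oo Y) $ i = (G oo Y) $ i"
  unfolding fps_compose_nth using assms by (intro sum.cong) auto

text \<open>The \<open>i\<close>-th coefficient of \<open>F oo Y\<close> involves the coefficients of \<open>F\<close> up to \<open>i\<close> only, so the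
  substitution preserves agreement below \<open>N\<close>.\<close>

lemma fps_sums_compose:
  fixes f :: "nat \<Rightarrow> 'a :: comm_ring_1 fps"
  assumes "\<And>N i. i < N \<Longrightarrow> (\<Sum>k<N. f k) $ i = S $ i"
  shows "(\<lambda>k. f k oo Y) sums (S oo Y)"
proof (rule fps_sumsI)
  fix N i :: nat
  assume "i < N"
  thus "(\<Sum>k<N. f k oo Y) $ i = (S oo Y) $ i"
    unfolding fps_compose_sum_distrib[symmetric]
    by (intro fps_compose_nth_cong_below[of N]) (auto intro: assms)
qed

section \<open>Termwise weighting of coefficients\<close>

definition hadamard :: "(nat \<Rightarrow> 'a) \<Rightarrow> 'a :: comm_ring_1 fps \<Rightarrow> 'a fps" where
  "hadamard w f = Abs_fps (\<lambda>k. w k * f $ k)"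

lemma hadamard_nth [simp]: "hadamard w f $ k = w k * f $ k"
  by (simp add: hadamard_def)

lemma hadamard_diff: "hadamard w (f - g) = hadamard w f - hadamard w g"
  by (simp add: fps_eq_iff algebra_simps)

lemma hadamard_const_mult: "hadamard w (fps_const c * f) = fps_const c * hadamard w f"
  by (simp add: fps_eq_iff algebra_simps)

text \<open>The shape of the sums in the theorem, where \<open>L\<close> is the logarithm and \<open>g\<close>, \<open>b\<close> are the
  generating functions of the hyperharmonic numbers and of the binomial coefficients.\<close>

lemma partial_sum_hadamard_nth:
  fixes L :: "'a :: comm_ring_1 fps"
  assumes "i < N"
  shows "(\<Sum>k<N. fps_const (w k) * (fps_const (g $ k) + fps_const (b $ k) * L) * fps_X ^ k) $ i =
         (hadamard w g + L * hadamard w b) $ i"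
proof -
  have trunc: "(\<Sum>k<N. fps_const (h $ k) * fps_X ^ k) $ j = h $ j" if "j < N"
    for h :: "'a fps" and j
    using that by (simp add: fps_sum_nth if_distrib cong: if_cong)
  have "(\<Sum>k<N. fps_const (w k) * (fps_const (g $ k) + fps_const (b $ k) * L) * fps_X ^ k) =
        (\<Sum>k<N. fps_const (hadamard w g $ k) * fps_X ^ k) +
        L * (\<Sum>k<N. fps_const (hadamard w b $ k) * fps_X ^ k)"
    by (simp add: sum.distrib[symmetric] sum_distrib_left algebra_simps flip: fps_const_mult)
  also have "\<dots> $ i = (hadamard w g + L * hadamard w b) $ i"
    unfolding fps_add_nth fps_mult_nth using assms
    by (intro arg_cong2[of _ _ _ _ "(+)"] sum.cong) (auto simp: trunc simp del: hadamard_nth)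
  finally show ?thesis .
qed

section \<open>Real powers of \<open>1 - X\<close> and of \<open>1 + X\<close>\<close>

lemma rpow_one_minus_X_nth: "fps_rpow (1 - fps_X) a $ k = (-1) ^ k * (a gchoose k)"
  by (simp add: fps_rpow_def fps_compose_uminus')

lemma rpow_one_minus_X_neq_0 [simp]: "fps_rpow (1 - fps_X) a \<noteq> 0"
  using rpow_one_minus_X_nth[of a 0] by auto

lemma rpow_one_minus_X_add:
  "fps_rpow (1 - fps_X) (a + b) = fps_rpow (1 - fps_X) a * fps_rpow (1 - fps_X) b"
  by (simp add: fps_rpow_def fps_binomial_add_mult fps_compose_mult_distrib)

lemma rpow_one_minus_X_0 [simp]: "fps_rpow (1 - fps_X) 0 = 1"
  by (simp add: fps_rpow_def)

lemma rpow_one_minus_X_minus: "fps_rpow (1 - fps_X) (- a) = 1 / fps_rpow (1 - fps_X) a"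
proof -
  have "fps_rpow (1 - fps_X) (- a) * fps_rpow (1 - fps_X) a = 1"
    by (simp flip: rpow_one_minus_X_add)
  thus ?thesis
    by (metis nonzero_mult_div_cancel_right rpow_one_minus_X_neq_0)
qed

lemma rpow_one_minus_X_of_nat: "fps_rpow (1 - fps_X) (real m) = (1 - fps_X) ^ m"
  by (simp add: fps_rpow_def fps_binomial_of_nat fps_compose_power[symmetric]
      fps_compose_add_distrib)

lemma rpow_one_minus_X_minus_nat_nth:
  assumes "r \<ge> 1"
  shows "fps_rpow (1 - fps_X) (- real r) $ k = real ((r + k - 1) choose k)"
proof -
  have "fps_rpow (1 - fps_X) (- real r) $ k = (real r + real k - 1) gchoose k"
    by (simp add: rpow_one_minus_X_nth gbinomial_minus flip: power_mult_distrib mult.assoc)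
  also have "real r + real k - 1 = real (r + k - 1)"
    using assms by (simp add: of_nat_diff)
  finally show ?thesis
    by (simp add: binomial_gbinomial)
qed

lemma one_minus_X_over_one_plus_X:
  "1 - fps_X / (1 + fps_X) = (1 / (1 + fps_X) :: real fps)"
proof -
  have "inverse (1 + fps_X) * (1 + fps_X) = (1 :: real fps)"
    by (rule inverse_mult_eq_1) simp
  hence "1 - fps_X * inverse (1 + fps_X) = (inverse (1 + fps_X) :: real fps)"
    by algebra
  thus ?thesis
    by (simp add: fps_divide_unit)
qed

text \<open>The substituted series solves the differential equation \<open>(1 + X) F' = - a F\<close>, which
  characterises \<open>(1 + X) powr (-a)\<close>.\<close>

lemma rpow_inverse_one_plus_X: "fps_rpow (1 / (1 + fps_X)) a = fps_binomial (- a)"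
proof -
  define G :: "real fps" where "G = inverse (1 + fps_X) - 1"
  have G0: "G $ 0 = 0" by (simp add: G_def)
  have inv: "inverse (1 + fps_X) * (1 + fps_X) = (1 :: real fps)"
    by (rule inverse_mult_eq_1) simp
  have "fps_deriv (fps_binomial a) = fps_const a * fps_binomial a * inverse (1 + fps_X)"
    by (simp add: fps_binomial_deriv fps_divide_unit)
  moreover have "inverse (1 + fps_X) oo G = 1 + fps_X"
    using G0 by (simp add: fps_inverse_compose fps_compose_add_distrib, simp add: G_def)
  moreover have "fps_deriv G = - (inverse (1 + fps_X) * inverse (1 + fps_X))"
    by (simp add: G_def fps_inverse_deriv power2_eq_square)
  ultimately have "fps_deriv (fps_binomial a oo G) =
      fps_const a * (fps_binomial a oo G) * (1 + fps_X) *
      - (inverse (1 + fps_X) * inverse (1 + fps_X))"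
    by (simp add: fps_compose_deriv G0 fps_compose_mult_distrib)
  also have "\<dots> = - fps_const a * (fps_binomial a oo G) * inverse (1 + fps_X) *
      (inverse (1 + fps_X) * (1 + fps_X))"
    by (simp only: mult_ac mult_minus_left mult_minus_right)
  also have "\<dots> = fps_const (- a) * (fps_binomial a oo G) / (1 + fps_X)"
    unfolding inv by (simp add: fps_divide_unit flip: fps_const_neg)
  finally have "fps_binomial a oo G = fps_binomial (- a)"
    by (subst fps_binomial_ODE_unique'[symmetric]) simp
  thus ?thesis
    by (simp add: fps_rpow_def G_def fps_divide_unit)
qed

lemma rpow_one_plus_X: "fps_rpow (1 + fps_X) a = fps_binomial a"
  by (simp add: fps_rpow_def)

lemma rpow_one_minus_X_compose:
  "fps_rpow (1 - fps_X) a oo (fps_X / (1 + fps_X)) = fps_binomial (- a)"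
proof -
  define Y :: "real fps" where "Y = fps_X / (1 + fps_X)"
  have Y0: "Y $ 0 = 0" by (simp add: Y_def fps_divide_unit)
  have "fps_rpow (1 - fps_X) a oo Y = fps_binomial a oo ((1 - fps_X - 1) oo Y)"
    unfolding fps_rpow_def using Y0 by (intro fps_compose_assoc[symmetric]) auto
  also have "(1 - fps_X - 1) oo Y = 1 / (1 + fps_X) - 1"
    using one_minus_X_over_one_plus_X by (simp add: fps_compose_uminus Y0 Y_def algebra_simps)
  also have "fps_binomial a oo \<dots> = fps_binomial (- a)"
    by (simp add: fps_rpow_def flip: rpow_inverse_one_plus_X)
  finally show ?thesis by (simp add: Y_def)
qed

lemma X_over_one_minus_X_compose:
  "(fps_X / (1 - fps_X)) oo (fps_X / (1 + fps_X)) = (fps_X :: real fps)"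
proof -
  define Y :: "real fps" where "Y = fps_X / (1 + fps_X)"
  have Y0: "Y $ 0 = 0" by (simp add: Y_def fps_divide_unit)
  have "(fps_X / (1 - fps_X)) oo Y = Y * inverse (1 - Y)"
    by (simp add: fps_divide_unit fps_compose_mult_distrib Y0 fps_inverse_compose
        fps_compose_sub_distrib)
  also have "1 - Y = inverse (1 + fps_X)"
    unfolding Y_def one_minus_X_over_one_plus_X by (simp add: fps_divide_unit)
  also have "Y * inverse (inverse (1 + fps_X)) = fps_X"
    by (simp add: Y_def fps_divide_unit mult.assoc inverse_mult_eq_1)
  finally show ?thesis by (simp add: Y_def)
qed

section \<open>Degenerate Stirling numbers\<close>

text \<open>This is \<open>m!\<close> times the degenerate Stirling number of the second kind. As \<open>\<lambda>\<close> tends to \<open>0\<close>, it tends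
  to the number of surjections from an \<open>n\<close>-set onto an \<open>m\<close>-set.\<close>

definition dsurj :: "real \<Rightarrow> nat \<Rightarrow> nat \<Rightarrow> real" where
  "dsurj lam n m = fact n * ((dexp lam - 1) ^ m) $ n"

lemma dsurj_eq_0:
  assumes "n < m"
  shows "dsurj lam n m = 0"
proof -
  have "(dexp lam - 1) $ 0 = 0" by (simp add: dexp_def fps_rpow_def)
  thus ?thesis
    using assms startsby_zero_power_prefix[of "dexp lam - 1" m] by (simp add: dsurj_def)
qed

lemma dexp_power_nth:
  assumes "lam \<noteq> 0"
  shows "(dexp lam ^ k) $ n = dfall (real k) n lam / fact n"
proof -
  have "dexp lam ^ k = fps_binomial (real k / lam) oo (fps_const lam * fps_X)"
    by (simp add: dexp_def fps_rpow_def fps_compose_power fps_binomial_power)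
  hence "(dexp lam ^ k) $ n = lam ^ n * ((real k / lam) gchoose n)"
    by (simp add: fps_compose_linear)
  also have "\<dots> = (\<Prod>i<n. lam * (real k / lam - real i)) / fact n"
    by (simp add: gbinomial_prod_rev prod.distrib atLeast0LessThan)
  also have "(\<Prod>i<n. lam * (real k / lam - real i)) = dfall (real k) n lam"
    unfolding dfall_def using assms by (intro prod.cong) (auto simp: field_simps)
  finally show ?thesis .
qed

text \<open>Compare coefficients of \<open>t ^ n\<close> in \<open>e\<^sub>\<lambda>(t) ^ k = (1 + (e\<^sub>\<lambda>(t) - 1)) ^ k\<close>.\<close>

lemma dfall_eq_sum_dsurj:
  assumes "lam \<noteq> 0"
  shows "dfall (real k) n lam = (\<Sum>m\<le>n. dsurj lam n m * real (k choose m))"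
proof -
  have "dexp lam ^ k = ((dexp lam - 1) + 1) ^ k" by simp
  also have "\<dots> = (\<Sum>m\<le>k. of_nat (k choose m) * (dexp lam - 1) ^ m)"
    by (subst binomial_ring) simp
  also have "fact n * \<dots> $ n = (\<Sum>m\<le>k. dsurj lam n m * real (k choose m))"
    unfolding fps_sum_nth sum_distrib_left
    by (intro sum.cong) (simp_all add: dsurj_def fps_of_nat[symmetric] del: fps_of_nat)
  also have "\<dots> = (\<Sum>m\<le>max n k. dsurj lam n m * real (k choose m))"
    by (rule sum.mono_neutral_left) auto
  also have "\<dots> = (\<Sum>m\<le>n. dsurj lam n m * real (k choose m))"
    by (rule sum.mono_neutral_right) (auto simp: dsurj_eq_0)
  finally show ?thesis using assms by (simp add: dexp_power_nth)
qed

lemma hadamard_dsurj_compose: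
  assumes "Z $ 0 = 0"
  shows "hadamard (dsurj lam n) f oo Z = (\<Sum>m\<le>n. fps_const (dsurj lam n m * f $ m) * Z ^ m)"
proof -
  have "hadamard (dsurj lam n) f = (\<Sum>m\<le>n. fps_const (dsurj lam n m * f $ m) * fps_X ^ m)"
    by (intro fps_ext)
       (simp add: fps_sum_nth if_distrib dsurj_eq_0 not_le cong: if_cong del: fps_const_mult)
  thus ?thesis
    using assms
    by (simp add: fps_compose_sum_distrib fps_compose_mult_distrib fps_compose_power[symmetric])
qed

text \<open>This is \<open>(k choose m) * (a gchoose k) = (a gchoose m) * ((a - m) gchoose (k - m))\<close> in terms
  of generating functions; analytically, it computes \<open>X ^ m / m!\<close> times the \<open>m\<close>-th derivative of
  \<open>(1 - X) powr a\<close>.\<close>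

lemma hadamard_choose_rpow:
  "hadamard (\<lambda>k. real (k choose m)) (fps_rpow (1 - fps_X) a) =
   fps_const (fps_rpow (1 - fps_X) a $ m) * fps_X ^ m * fps_rpow (1 - fps_X) (a - real m)"
proof (rule fps_ext)
  fix k
  show "hadamard (\<lambda>k. real (k choose m)) (fps_rpow (1 - fps_X) a) $ k =
    (fps_const (fps_rpow (1 - fps_X) a $ m) * fps_X ^ m * fps_rpow (1 - fps_X) (a - real m)) $ k"
  proof (cases "m \<le> k")
    case True
    have "(a gchoose k) * real (k choose m) = (a gchoose m) * (a - real m gchoose (k - m))"
      using gbinomial_trinomial_revision[OF True, of a] by (simp add: binomial_gbinomial)
    moreover have "(-1) ^ k = ((-1) ^ m * (-1) ^ (k - m) :: real)"
      using True by (simp flip: power_add)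
    ultimately show ?thesis
      using True by (simp add: rpow_one_minus_X_nth mult_ac fps_X_power_mult_nth)
  next
    case False
    thus ?thesis by (simp add: mult.assoc fps_X_power_mult_nth)
  qed
qed

text \<open>The factor \<open>X ^ m * (1 - X) powr (a - m)\<close> that the weight \<open>k choose m\<close> produces is
  \<open>(1 - X) powr a * (X / (1 - X)) ^ m\<close>; hence the power comes out of the sum over \<open>m\<close>, and
  \<open>X / (1 - X)\<close> appears as the new argument.\<close>

theorem hadamard_dfall_rpow:
  assumes "lam \<noteq> 0"
  shows "hadamard (\<lambda>k. dfall (real k) n lam) (fps_rpow (1 - fps_X) a) =
         fps_rpow (1 - fps_X) a *
         (hadamard (dsurj lam n) (fps_rpow (1 - fps_X) a) oo (fps_X / (1 - fps_X)))"
proof -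
  define B where "B = fps_rpow (1 - fps_X)"
  define Z :: "real fps" where "Z = fps_X / (1 - fps_X)"
  have Z0: "Z $ 0 = 0" by (simp add: Z_def fps_divide_unit)
  have Z_pow: "B a * Z ^ m = fps_X ^ m * B (a - real m)" for m
  proof -
    have "B a = B (a - real m) * (1 - fps_X) ^ m"
      using rpow_one_minus_X_add[of "a - real m" "real m"]
      by (simp add: B_def rpow_one_minus_X_of_nat)
    moreover have "(1 - fps_X) ^ m * Z ^ m = fps_X ^ m"
      by (simp add: Z_def power_mult_distrib[symmetric] fps_divide_unit mult.left_commute
          inverse_mult_eq_1')
    ultimately show ?thesis by (simp add: mult_ac)
  qed
  have "hadamard (\<lambda>k. dfall (real k) n lam) (B a) =
      (\<Sum>m\<le>n. fps_const (dsurj lam n m) * hadamard (\<lambda>k. real (k choose m)) (B a))"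
    using assms
    by (intro fps_ext) (simp add: dfall_eq_sum_dsurj fps_sum_nth sum_distrib_right mult.assoc)
  also have "\<dots> = (\<Sum>m\<le>n. fps_const (dsurj lam n m * B a $ m) * (B a * Z ^ m))"
    unfolding Z_pow
    by (simp add: B_def hadamard_choose_rpow mult.assoc flip: fps_const_mult)
  also have "\<dots> = B a * (hadamard (dsurj lam n) (B a) oo Z)"
    by (simp add: hadamard_dsurj_compose[OF Z0] sum_distrib_left mult.left_commute)
  finally show ?thesis by (simp add: B_def Z_def)
qed

section \<open>The Fubini side\<close>

lemma fps_lift_power: "fps_lift (f ^ i) = fps_lift f ^ i"
proof (induction i)
  case 0
  show ?case by (simp add: fps_lift_def fps_eq_iff one_pCons)
next
  case (Suc i)
  have "fps_lift (f * g) = fps_lift f * fps_lift g" for f g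
    by (intro fps_ext)
       (simp add: fps_lift_def fps_mult_nth poly_eq_iff coeff_sum coeff_pCons mult.commute
         split: nat.splits)
  thus ?case by (simp add: Suc)
qed

text \<open>In the generating function, \<open>y ^ m\<close> arises from the \<open>m\<close>-th power of \<open>y (e\<^sub>\<lambda>(t) - 1)\<close> alone.\<close>

lemma fps_of_poly_HF:
  assumes "r \<ge> 1"
  shows "fps_of_poly (HF lam r n) = hadamard (dsurj lam n) (Abs_fps (dhyper lam r))"
proof (rule fps_ext)
  fix i
  have gf: "- dlog lam (1 - fps_X) / (1 - fps_X) ^ r = Abs_fps (dhyper lam r)"
    using assms dhyper_gf[of lam "r - 1"] by simp
  have lift_nth: "fps_lift f $ m = [:f $ m:]" for f m
    by (simp add: fps_lift_def)
  have coeff_term: "coeff ([:a:] * ((fps_const [:0, 1:] * fps_lift f) ^ m $ n)) i =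
      (if i = m then a * (f ^ m) $ n else 0)" for a :: real and f m
  proof -
    have "(fps_const [:0, 1:] * fps_lift f) ^ m $ n = [:0, 1:] ^ m * [:(f ^ m) $ n:]"
      by (simp add: power_mult_distrib fps_const_power fps_lift_power[symmetric] del: fps_const_power)
         (simp add: lift_nth)
    also have "\<dots> = monom ((f ^ m) $ n) m"
      by (simp add: monom_altdef)
    finally show ?thesis by simp
  qed
  have "fps_of_poly (HF lam r n) $ i =
      fact n * (\<Sum>m=0..n. if i = m then dhyper lam r m * ((dexp lam - 1) ^ m) $ n else 0)"
    unfolding HF_def HF_gf_def gf fps_of_poly_nth coeff_smult fps_compose_nth coeff_sum
    by (simp only: lift_nth coeff_term fps_nth_Abs_fps)
  also have "\<dots> = dsurj lam n i * dhyper lam r i"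
    by (simp add: dsurj_eq_0) (simp add: dsurj_def)
  finally show "fps_of_poly (HF lam r n) $ i =
      hadamard (dsurj lam n) (Abs_fps (dhyper lam r)) $ i"
    by simp
qed

section \<open>The two expansions\<close>

lemma dhyper_gf_eq_rpow:
  assumes "r \<ge> 1"
  shows "Abs_fps (dhyper lam r) =
    fps_const (1 / lam) * (fps_rpow (1 - fps_X) (- real r) - fps_rpow (1 - fps_X) (lam - real r))"
proof -
  have "Abs_fps (dhyper lam r) = - dlog lam (1 - fps_X) / (1 - fps_X) ^ r"
    using assms dhyper_gf[of lam "r - 1"] by simp
  also have "\<dots> = - dlog lam (1 - fps_X) * fps_rpow (1 - fps_X) (- real r)"
    by (simp add: rpow_one_minus_X_minus rpow_one_minus_X_of_nat fps_divide_unit)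
  also have "\<dots> = fps_const (1 / lam) *
      (fps_rpow (1 - fps_X) (- real r) - fps_rpow (1 - fps_X) (lam - real r))"
    using rpow_one_minus_X_add[of lam "- real r"] by (simp add: dlog_def algebra_simps)
  finally show ?thesis .
qed

text \<open>Put \<open>B a = (1 - X) powr a\<close>. Since \<open>log\<^sub>\<lambda>(1 - X) = (B \<lambda> - 1) / \<lambda>\<close>, the second summand turns the
  contribution of \<open>B (-r)\<close> to the first one into \<open>B \<lambda>\<close> times itself, and
  \<open>hadamard_dfall_rpow\<close> then gives both contributions the common factor \<open>B (\<lambda> - r)\<close>.\<close>

lemma hadamard_dfall_dhyper:
  assumes "lam \<noteq> 0" and "r \<ge> 1"
  shows "hadamard (\<lambda>k. dfall (real k) n lam) (Abs_fps (dhyper lam r)) +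
           dlog lam (1 - fps_X) *
           hadamard (\<lambda>k. dfall (real k) n lam) (fps_rpow (1 - fps_X) (- real r)) =
         fps_rpow (1 - fps_X) (lam - real r) *
           (fps_of_poly (HF lam r n) oo (fps_X / (1 - fps_X)))"
proof -
  define B where "B = fps_rpow (1 - fps_X)"
  define D where "D = hadamard (\<lambda>k. dfall (real k) n lam)"
  define T where "T f = hadamard (dsurj lam n) f oo (fps_X / (1 - fps_X))" for f
  define c where "c = fps_const (1 / lam)"
  have D_B: "D (B a) = B a * T (B a)" for a
    using hadamard_dfall_rpow[OF assms(1)] by (simp add: B_def D_def T_def)
  have gf: "Abs_fps (dhyper lam r) = c * (B (- real r) - B (lam - real r))"
    using assms(2) by (simp add: dhyper_gf_eq_rpow c_def B_def)
  have D_gf: "D (Abs_fps (dhyper lam r)) = c * (D (B (- real r)) - D (B (lam - real r)))"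
    by (simp only: gf D_def c_def hadamard_const_mult hadamard_diff)
  have "fps_of_poly (HF lam r n) oo (fps_X / (1 - fps_X)) = T (Abs_fps (dhyper lam r))"
    using assms(2) by (simp add: fps_of_poly_HF T_def)
  also have "\<dots> = c * (T (B (- real r)) - T (B (lam - real r)))"
    by (simp add: gf T_def c_def hadamard_const_mult hadamard_diff fps_compose_mult_distrib
        fps_compose_sub_distrib fps_divide_unit)
  finally have HF: "fps_of_poly (HF lam r n) oo (fps_X / (1 - fps_X)) = \<dots>" .
  have "D (Abs_fps (dhyper lam r)) + dlog lam (1 - fps_X) * D (B (- real r)) =
      c * (B lam * D (B (- real r)) - D (B (lam - real r)))"
    unfolding D_gf by (simp add: dlog_def B_def c_def algebra_simps)
  also have "\<dots> = B (lam - real r) * (c * (T (B (- real r)) - T (B (lam - real r))))"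
  proof -
    have "B (lam - real r) = B lam * B (- real r)"
      using rpow_one_minus_X_add[of lam "- real r"] by (simp add: B_def)
    thus ?thesis unfolding D_B by algebra
  qed
  finally show ?thesis by (simp only: HF B_def D_def)
qed

theorem theorem6:
  fixes lam :: real and n r :: nat
  assumes "lam \<noteq> 0" and "r \<ge> 1"
  shows "summable (\<lambda>k. fps_const (dfall (real k) n lam) *
             (fps_const (dhyper lam r k) + of_nat ((r + k - 1) choose k) * dlog lam (1 - fps_X)) *
             fps_X ^ k)
       \<and> 1 / (1 - fps_X) ^ r * (fps_of_poly (HF lam r n) oo (fps_X / (1 - fps_X))) =
         1 / fps_rpow (1 - fps_X) lam *
           (\<Sum>k. fps_const (dfall (real k) n lam) *
             (fps_const (dhyper lam r k) + of_nat ((r + k - 1) choose k) * dlog lam (1 - fps_X)) *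
             fps_X ^ k)
       \<and> summable (\<lambda>k. fps_const (dfall (real k) n lam) *
             (fps_const (dhyper lam r k) +
              of_nat ((r + k - 1) choose k) * dlog lam (1 / (1 + fps_X))) *
             (fps_X / (1 + fps_X)) ^ k)
       \<and> fps_of_poly (HF lam r n) =
         fps_rpow (1 + fps_X) (lam - real r) *
           (\<Sum>k. fps_const (dfall (real k) n lam) *
             (fps_const (dhyper lam r k) +
              of_nat ((r + k - 1) choose k) * dlog lam (1 / (1 + fps_X))) *
             (fps_X / (1 + fps_X)) ^ k)"
proof -
  define w where "w = (\<lambda>k. dfall (real k) n lam)"
  define H where "H = fps_of_poly (HF lam r n)"
  define Y :: "real fps" where "Y = fps_X / (1 + fps_X)"
  define S where "S = fps_rpow (1 - fps_X) (lam - real r) * (H oo (fps_X / (1 - fps_X)))"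
  define f where "f k = fps_const (w k) *
      (fps_const (dhyper lam r k) + of_nat ((r + k - 1) choose k) * dlog lam (1 - fps_X)) *
      fps_X ^ k" for k
  have Y0: "Y $ 0 = 0" by (simp add: Y_def fps_divide_unit)
  have partial: "(\<Sum>k<N. f k) $ i = S $ i" if "i < N" for N i
  proof -
    have "(\<Sum>k<N. f k) $ i = (hadamard w (Abs_fps (dhyper lam r)) +
        dlog lam (1 - fps_X) * hadamard w (fps_rpow (1 - fps_X) (- real r))) $ i"
      using partial_sum_hadamard_nth[OF that, of w "Abs_fps (dhyper lam r)"
          "fps_rpow (1 - fps_X) (- real r)" "dlog lam (1 - fps_X)"] assms(2)
      by (simp add: rpow_one_minus_X_minus_nat_nth f_def fps_of_nat)
    thus ?thesis
      using hadamard_dfall_dhyper[OF assms, of n] by (simp only: w_def S_def H_def)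
  qed

  have sums1: "f sums S"
    using partial by (rule fps_sumsI)
  have id1: "1 / (1 - fps_X) ^ r * (H oo (fps_X / (1 - fps_X))) =
      1 / fps_rpow (1 - fps_X) lam * S"
  proof -
    have "1 / (1 - fps_X) ^ r = fps_rpow (1 - fps_X) (- real r)"
      by (simp add: rpow_one_minus_X_minus rpow_one_minus_X_of_nat)
    also have "\<dots> = fps_rpow (1 - fps_X) (- lam) * fps_rpow (1 - fps_X) (lam - real r)"
      by (simp flip: rpow_one_minus_X_add)
    finally show ?thesis
      by (simp add: S_def rpow_one_minus_X_minus mult.assoc)
  qed

  have dlog_Y: "dlog lam (1 - fps_X) oo Y = dlog lam (1 / (1 + fps_X))"
    using rpow_one_minus_X_compose[of lam]
    by (simp add: dlog_def fps_compose_mult_distrib Y0 fps_compose_sub_distrib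
        rpow_inverse_one_plus_X flip: Y_def)
  have f_Y: "f k oo Y = fps_const (w k) *
      (fps_const (dhyper lam r k) + of_nat ((r + k - 1) choose k) * dlog lam (1 / (1 + fps_X))) *
      Y ^ k" for k
    unfolding f_def fps_of_nat[symmetric]
    by (simp add: fps_compose_mult_distrib Y0 fps_compose_add_distrib dlog_Y
        fps_compose_power[symmetric])
  have sums2: "(\<lambda>k. f k oo Y) sums (S oo Y)"
    using partial by (rule fps_sums_compose)
  have id2: "H = fps_rpow (1 + fps_X) (lam - real r) * (S oo Y)"
  proof -
    have "S oo Y = fps_binomial (- (lam - real r)) * (H oo (fps_X / (1 - fps_X)) oo Y)"
      using rpow_one_minus_X_compose[of "lam - real r"]
      by (simp add: S_def fps_compose_mult_distrib Y0 flip: Y_def)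
    also have "H oo (fps_X / (1 - fps_X)) oo Y = H oo ((fps_X / (1 - fps_X)) oo Y)"
      using Y0 by (intro fps_compose_assoc[symmetric]) (auto simp: fps_divide_unit)
    also have "\<dots> = H"
      by (simp add: Y_def X_over_one_minus_X_compose)
    finally have "S oo Y = fps_binomial (- (lam - real r)) * H" .
    thus ?thesis
      by (simp add: rpow_one_plus_X mult.assoc[symmetric] fps_binomial_add_mult[symmetric])
  qed

  from sums1 sums2 id1 id2 show ?thesis
    unfolding f_Y unfolding f_def w_def H_def Y_def
    by (simp only: sums_iff)
qed

end
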